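(* Let $f:\mathcal{H}\to\mathbb{R}$ be nonnegative and of class $C^1$. Then the eikonal equation $\|\nabla\psi\|^2=f$ on $\mathcal{H}$ has at most one (up to an additive constant) solution $\psi\in C^2(\mathcal{H})$ that is convex and bounded below.
   Context: $\mathcal{H}$ is a real Hilbert space with norm $\|\cdot\|$; $C^2(\mathcal{H})$ denotes the real-valued functions of class $C^2$ on $\mathcal{H}$, and $\nabla$ denotes the gradient. *)

theory Defs
  imports "HOL-Analysis.Analysis"
begin

text \<open>Derivatives are taken as maps into the bounded linear operators, so continuity of
  a derivative is continuity in operator norm.\<close>

definition C1 :: "('a::real_normed_vector \<Rightarrow> 'b::real_normed_vector) \<Rightarrow> bool" where
  "C1 f \<longleftrightarrow> (\<exists>f' :: 'a \<Rightarrow> 'a \<Rightarrow>\<^sub>L 'b.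
      (\<forall>x. (f has_derivative blinfun_apply (f' x)) (at x)) \<and> continuous_on UNIV f')"

definition C2 :: "('a::real_normed_vector \<Rightarrow> 'b::real_normed_vector) \<Rightarrow> bool" where
  "C2 f \<longleftrightarrow> (\<exists>f' :: 'a \<Rightarrow> 'a \<Rightarrow>\<^sub>L 'b.
      (\<forall>x. (f has_derivative blinfun_apply (f' x)) (at x)) \<and> C1 f')"

text \<open>For a differentiable function on a Hilbert space the gradient exists by the Riesz
  representation theorem; where no gradient exists, the value is unspecified.\<close>

definition gradient :: "('a::real_inner \<Rightarrow> real) \<Rightarrow> 'a \<Rightarrow> 'a" where
  "gradient f x = (THE D. GDERIV f x :> D)"

lemma gradient_eqI:
  assumes "GDERIV f x :> D"
  shows "gradient f x = D"
  unfolding gradient_def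
proof (rule the_equality)
  show "GDERIV f x :> D"
    by (fact assms)
next
  fix E assume "GDERIV f x :> E"
  then have "(\<lambda>h. inner h E) = (\<lambda>h. inner h D)"
    using assms has_derivative_unique unfolding gderiv_def by blast
  then have "inner (E - D) (E - D) = 0"
    by (metis inner_diff_right diff_self)
  then show "E = D"
    by simp
qed

end

theory Submission
  imports Defs
begin

text \<open>
  Both functions have the same gradient norm, so along a steepest descent curve of
  \<open>\<psi>\<^sub>1\<close> the function \<open>\<psi>\<^sub>1\<close> decreases at the rate \<open>f\<close>, while by Cauchy--Schwarz \<open>\<psi>\<^sub>2\<close> decreases
  at most at the rate \<open>f\<close>. Hence \<open>\<psi>\<^sub>1 - \<psi>\<^sub>2\<close> does not increase along the curve. If
  \<open>\<psi>\<^sub>2\<close> moreover tends to its infimum along the curve, then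
  \<open>\<psi>\<^sub>1 x - \<psi>\<^sub>2 x \<ge> inf \<psi>\<^sub>1 - inf \<psi>\<^sub>2\<close>, and exchanging the roles of the two functions gives
  equality, which is the claim.

  The curve is replaced here by the proximal point iteration
  \<open>y\<^sub>n\<^sub>+\<^sub>1 = y\<^sub>n - \<tau> \<nabla>\<psi>\<^sub>1(y\<^sub>n\<^sub>+\<^sub>1)\<close> with a fixed step \<open>\<tau> > 0\<close>, that is, by the implicit Euler scheme
  of the gradient flow. It is defined for all time because each step minimizes a strongly
  convex function (\<open>proximal_point_exists\<close>), and it keeps the estimates of the flow:

  \<^item> The numbers \<open>G\<^sub>n = \<parallel>\<nabla>\<psi>\<^sub>1(y\<^sub>n)\<parallel>\<close> decrease, and \<open>\<tau> \<Sum> G\<^sub>n\<^sub>+\<^sub>1\<^sup>2\<close> is at most \<open>\<psi>\<^sub>1(y\<^sub>0) - inf \<psi>\<^sub>1\<close>.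

  \<^item> These two facts imply \<open>G\<^sub>n \<parallel>y\<^sub>n - z\<parallel> \<longlonglongrightarrow> 0\<close> for every \<open>z\<close>
    (\<open>decseq_times_partial_sum_tendsto_zero\<close>). As \<open>\<psi>\<^sub>2\<close> has a gradient of the same norm, its
    tangent inequality at \<open>y\<^sub>n\<close> gives \<open>limsup \<psi>\<^sub>2(y\<^sub>n) \<le> \<psi>\<^sub>2 z\<close>. This covers the case
    that the infima are not attained and \<open>y\<^sub>n\<close> escapes to infinity.

  \<^item> One step increases \<open>\<psi>\<^sub>1 - \<psi>\<^sub>2\<close> by at most \<open>\<tau> G\<^sub>0 (G\<^sub>n - G\<^sub>n\<^sub>+\<^sub>1)\<close>. These errors telescope to
    at most \<open>\<tau> G\<^sub>0\<^sup>2\<close>, uniformly in the number of steps, and vanish as \<open>\<tau> \<rightarrow> 0\<close>.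
\<close>

section \<open>Minimization in Hilbert space\<close>

text \<open>Strong midpoint convexity turns every minimizing sequence into a Cauchy sequence:
  the value at the midpoint of two almost minimal points cannot drop below the infimum,
  so the points are close.\<close>

lemma strongly_midconvex_attains_minimum:
  fixes \<phi> :: "'a::{real_normed_vector,complete_space} \<Rightarrow> real"
  assumes cont: "continuous_on UNIV \<phi>"
    and bdd: "bdd_below (range \<phi>)"
    and c: "c > 0"
    and mid: "\<And>a b. \<phi> ((1/2) *\<^sub>R (a + b)) \<le> (\<phi> a + \<phi> b) / 2 - c * (norm (a - b))\<^sup>2"
  shows "\<exists>z. \<forall>y. \<phi> z \<le> \<phi> y"
proof -
  define m where "m = Inf (range \<phi>)"
  have m_le: "m \<le> \<phi> y" for y
    unfolding m_def using bdd by (intro cInf_lower) auto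
  have "\<exists>y. \<phi> y < m + 1 / real (Suc n)" for n
    using cInf_lessD[of "range \<phi>" "m + 1 / real (Suc n)"] by (auto simp: m_def)
  then obtain u where u: "\<And>n. \<phi> (u n) < m + 1 / real (Suc n)"
    by metis
  have close: "c * (dist (u i) (u j))\<^sup>2 \<le> 1 / real (Suc N)" if "N \<le> i" "N \<le> j" for i j N
  proof -
    have small: "\<phi> (u k) < m + 1 / real (Suc N)" if "N \<le> k" for k
    proof -
      have "1 / real (Suc k) \<le> 1 / real (Suc N)"
        using that by (simp add: field_simps)
      with u[of k] show ?thesis by linarith
    qed
    from small[OF that(1)] small[OF that(2)] mid[of "u i" "u j"] m_le[of "(1/2) *\<^sub>R (u i + u j)"]
    show ?thesis
      unfolding dist_norm by argo
  qed
  have "Cauchy u"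
  proof (rule metric_CauchyI)
    fix e :: real assume e: "e > 0"
    then have "c * e\<^sup>2 > 0" using c by simp
    then obtain N where N: "1 / real (Suc N) < c * e\<^sup>2"
      using reals_Archimedean[of "c * e\<^sup>2"] by (auto simp: inverse_eq_divide)
    have "dist (u i) (u j) < e" if "N \<le> i" "N \<le> j" for i j
    proof -
      have "c * (dist (u i) (u j))\<^sup>2 < c * e\<^sup>2"
        using close[OF that] N by linarith
      then have "(dist (u i) (u j))\<^sup>2 < e\<^sup>2" using c by simp
      then show ?thesis using e by (meson less_imp_le power_less_imp_less_base)
    qed
    then show "\<exists>M. \<forall>m\<ge>M. \<forall>n\<ge>M. dist (u m) (u n) < e" by blast
  qed
  then obtain z where z: "u \<longlonglongrightarrow> z"
    using Cauchy_convergent_iff convergent_def by blast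
  have "isCont \<phi> z"
    using cont by (simp add: continuous_on_eq_continuous_at)
  then have "(\<lambda>n. \<phi> (u n)) \<longlonglongrightarrow> \<phi> z"
    using z isCont_tendsto_compose by blast
  moreover have "(\<lambda>n. m + 1 / real (Suc n)) \<longlonglongrightarrow> m + 0"
    by (intro tendsto_intros LIMSEQ_Suc[OF lim_1_over_n])
  ultimately have "\<phi> z \<le> m + 0"
    using u by (intro LIMSEQ_le) (auto intro: less_imp_le)
  then have "\<phi> z \<le> \<phi> y" for y
    using m_le[of y] by simp
  then show ?thesis by blast
qed

lemma norm_midpoint_power2:
  fixes a b :: "'a::real_inner"
  shows "(norm ((1/2) *\<^sub>R (a + b)))\<^sup>2 = ((norm a)\<^sup>2 + (norm b)\<^sup>2) / 2 - (norm (a - b))\<^sup>2 / 4"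
  by (simp add: power2_norm_eq_inner inner_simps inner_commute field_simps)

text \<open>This single existence statement serves two purposes: it gives the step of the
  proximal point iteration, and for a linear function it gives the Riesz representation.
  Hence the derivative is not yet written with a gradient.\<close>

lemma proximal_point_exists:
  fixes \<psi> :: "'a::{real_inner,complete_space} \<Rightarrow> real"
  assumes conv: "convex_on UNIV \<psi>"
    and der: "\<And>y. (\<psi> has_derivative \<psi>' y) (at y)"
    and l: "\<tau> > 0"
    and bdd: "bdd_below (range (\<lambda>y. \<psi> y + (norm (y - x))\<^sup>2 / (2 * \<tau>)))"
  shows "\<exists>z. \<forall>v. \<psi>' z v = - ((z - x) \<bullet> v) / \<tau>"
proof -
  let ?\<phi> = "\<lambda>y. \<psi> y + (norm (y - x))\<^sup>2 / (2 * \<tau>)"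
  have cont: "continuous_on UNIV \<psi>"
    using der has_derivative_continuous by (simp add: continuous_on_eq_continuous_at) blast
  have "\<exists>z. \<forall>y. ?\<phi> z \<le> ?\<phi> y"
  proof (rule strongly_midconvex_attains_minimum[where c = "1 / (8 * \<tau>)"])
    show "continuous_on UNIV ?\<phi>"
      using l by (intro continuous_intros cont) auto
    fix a b
    have "\<psi> ((1/2) *\<^sub>R (a + b)) \<le> (\<psi> a + \<psi> b) / 2"
      using convex_onD[OF conv, of "1/2" a b] by (simp add: scaleR_add_right field_simps)
    moreover have "(1/2) *\<^sub>R (a + b) - x = (1/2) *\<^sub>R ((a - x) + (b - x))"
      by (simp add: scaleR_right_diff_distrib scaleR_add_right algebra_simps
               flip: scaleR_add_left)
    then have mid_norm: "(norm ((1/2) *\<^sub>R (a + b) - x))\<^sup>2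
        = ((norm (a - x))\<^sup>2 + (norm (b - x))\<^sup>2) / 2 - (norm (a - b))\<^sup>2 / 4"
      by (simp only: norm_midpoint_power2) simp
    have "(norm ((1/2) *\<^sub>R (a + b) - x))\<^sup>2 / (2 * \<tau>)
        = ((norm (a - x))\<^sup>2 / (2 * \<tau>) + (norm (b - x))\<^sup>2 / (2 * \<tau>)) / 2
          - 1 / (8 * \<tau>) * (norm (a - b))\<^sup>2"
      unfolding mid_norm using l by (simp add: field_simps)
    ultimately show "?\<phi> ((1/2) *\<^sub>R (a + b)) \<le> (?\<phi> a + ?\<phi> b) / 2 - 1 / (8 * \<tau>) * (norm (a - b))\<^sup>2"
      by argo
  qed (use l bdd in auto)
  then obtain z where z: "\<And>y. ?\<phi> z \<le> ?\<phi> y" by blast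
  have d: "((\<lambda>y. \<psi> y + ((y - x) \<bullet> (y - x)) / (2 * \<tau>)) has_derivative
      (\<lambda>v. \<psi>' z v + ((z - x) \<bullet> v) / \<tau>)) (at z)"
    by (rule derivative_eq_intros der refl)+
       (use l in \<open>auto simp: inner_commute field_simps\<close>)
  have "(\<lambda>v. \<psi>' z v + ((z - x) \<bullet> v) / \<tau>) = (\<lambda>v. 0)"
    by (rule differential_zero_maxmin[OF _ open_UNIV d])
       (use z in \<open>auto simp: power2_norm_eq_inner\<close>)
  then have "\<psi>' z v = - ((z - x) \<bullet> v) / \<tau>" for v
    by (metis eq_neg_iff_add_eq_0 minus_divide_left)
  then show ?thesis by blast
qed

text \<open>The Riesz representation theorem: the representing vector is, up to sign, the
  proximal point of the origin for the functional itself.\<close>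

lemma riesz_representation:
  fixes L :: "'a::{real_inner,complete_space} \<Rightarrow> real"
  assumes "bounded_linear L"
  shows "\<exists>w. \<forall>v. L v = v \<bullet> w"
proof -
  interpret bounded_linear L by fact
  obtain K where K: "\<And>v. norm (L v) \<le> norm v * K"
    using bounded by blast
  have "- K\<^sup>2 / 2 \<le> L v + (norm (v - 0))\<^sup>2 / (2 * 1)" for v
  proof -
    have "0 \<le> (norm v - K)\<^sup>2" by simp
    moreover have "- (norm v * K) \<le> L v" using K[of v] by auto
    ultimately show ?thesis by (simp add: power2_diff)
  qed
  then have "bdd_below (range (\<lambda>v. L v + (norm (v - 0))\<^sup>2 / (2 * 1)))"
    by (intro bdd_belowI) auto
  moreover have "convex_on UNIV L"
    by (intro convex_onI) (auto simp: add scaleR)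
  moreover have "(L has_derivative L) (at y)" for y
    by (rule has_derivative) (rule has_derivative_ident)
  ultimately obtain z where "\<forall>v. L v = - ((z - 0) \<bullet> v) / 1"
    using proximal_point_exists[of L "\<lambda>_. L" 1 0] by auto
  then show ?thesis
    by (intro exI[of _ "- z"]) (simp add: inner_commute)
qed

lemma GDERIV_gradient:
  fixes \<psi> :: "'a::{real_inner,complete_space} \<Rightarrow> real"
  assumes "(\<psi> has_derivative \<psi>') (at x)"
  shows "GDERIV \<psi> x :> gradient \<psi> x"
proof -
  obtain w where "\<forall>v. \<psi>' v = v \<bullet> w"
    using riesz_representation has_derivative_bounded_linear[OF assms] by blast
  then have "\<psi>' = (\<lambda>v. v \<bullet> w)" by auto
  with assms have "GDERIV \<psi> x :> w"
    by (simp add: gderiv_def)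
  then show ?thesis
    using gradient_eqI by metis
qed

section \<open>Gradients of convex functions\<close>

lemma convex_tangent_inequality:
  fixes \<psi> :: "'a::real_inner \<Rightarrow> real"
  assumes conv: "convex_on UNIV \<psi>" and der: "GDERIV \<psi> x :> g"
  shows "\<psi> x + g \<bullet> (y - x) \<le> \<psi> y"
proof -
  define h where "h t = \<psi> (x + t *\<^sub>R (y - x))" for t
  have "convex_on UNIV h"
  proof (intro convex_onI)
    fix t a b :: real assume t: "0 < t" "t < 1"
    have "x + ((1 - t) * a + t * b) *\<^sub>R (y - x)
        = (1 - t) *\<^sub>R (x + a *\<^sub>R (y - x)) + t *\<^sub>R (x + b *\<^sub>R (y - x))"
      by (simp add: algebra_simps)
    then show "h ((1 - t) *\<^sub>R a + t *\<^sub>R b) \<le> (1 - t) * h a + t * h b"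
      using convex_onD[OF conv, of t] t by (simp add: h_def)
  qed simp
  moreover have "(h has_real_derivative g \<bullet> (y - x)) (at 0)"
  proof -
    have "((\<lambda>t. x + t *\<^sub>R (y - x)) has_derivative (\<lambda>t. t *\<^sub>R (y - x))) (at 0)"
      by (auto intro!: derivative_eq_intros)
    moreover have "(\<psi> has_derivative (\<lambda>v. v \<bullet> g)) (at (x + 0 *\<^sub>R (y - x)))"
      using der by (simp add: gderiv_def)
    ultimately have "((\<lambda>t. \<psi> (x + t *\<^sub>R (y - x))) has_derivative (\<lambda>t. (t *\<^sub>R (y - x)) \<bullet> g)) (at 0)"
      by (rule has_derivative_compose)
    then show ?thesis
      unfolding has_field_derivative_def h_def
      by (rule has_derivative_eq_rhs) (auto simp: inner_commute)
  qed
  ultimately have "h 1 - h 0 \<ge> (g \<bullet> (y - x)) * (1 - 0)"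
    by (intro convex_on_imp_above_tangent[of UNIV]) auto
  then show ?thesis by (simp add: h_def)
qed

lemma convex_gradient_monotone:
  fixes \<psi> :: "'a::real_inner \<Rightarrow> real"
  assumes "convex_on UNIV \<psi>" and "GDERIV \<psi> x :> g" and "GDERIV \<psi> y :> h"
  shows "0 \<le> (g - h) \<bullet> (x - y)"
  using convex_tangent_inequality[OF assms(1,2), of y]
    convex_tangent_inequality[OF assms(1,3), of x]
  by (simp add: inner_simps)

section \<open>The proximal point iteration\<close>

lemma proximal_sequence_exists:
  fixes \<psi> :: "'a::{real_inner,complete_space} \<Rightarrow> real"
  assumes conv: "convex_on UNIV \<psi>" and grad: "\<And>y. GDERIV \<psi> y :> g y"
    and bdd: "bdd_below (range \<psi>)" and l: "\<tau> > 0"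
  shows "\<exists>y. y 0 = x \<and> (\<forall>n. y (Suc n) = y n - \<tau> *\<^sub>R g (y (Suc n)))"
proof -
  have "\<exists>z. z = u - \<tau> *\<^sub>R g z" for u
  proof -
    obtain m where m: "\<And>y. m \<le> \<psi> y"
      using bdd by (auto simp: bdd_below_def)
    have "bdd_below (range (\<lambda>y. \<psi> y + (norm (y - u))\<^sup>2 / (2 * \<tau>)))"
      using l m by (intro bdd_belowI[of _ m]) (auto intro!: add_increasing2)
    moreover have "(\<psi> has_derivative (\<lambda>v. v \<bullet> g y)) (at y)" for y
      using grad by (simp add: gderiv_def)
    ultimately obtain z where z: "\<And>v. v \<bullet> g z = - ((z - u) \<bullet> v) / \<tau>"
      using proximal_point_exists[OF conv _ l, of "\<lambda>y v. v \<bullet> g y"] by blast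
    let ?r = "z - u + \<tau> *\<^sub>R g z"
    have "?r \<bullet> ?r = (z - u) \<bullet> ?r + \<tau> * (?r \<bullet> g z)"
      by (simp add: inner_add_left inner_add_right inner_diff_left inner_diff_right
            inner_commute algebra_simps)
    also have "\<dots> = 0"
      using z[of ?r] l by simp
    finally have "?r = 0" by simp
    then have "z = u - \<tau> *\<^sub>R g z"
      by (simp add: algebra_simps)
    then show ?thesis ..
  qed
  then obtain P where P: "\<And>u. P u = u - \<tau> *\<^sub>R g (P u)"
    by metis
  have "(P ^^ Suc n) x = (P ^^ n) x - \<tau> *\<^sub>R g ((P ^^ Suc n) x)" for n
    using P[of "(P ^^ n) x"] by simp
  then show ?thesis
    by (intro exI[of _ "\<lambda>n. (P ^^ n) x"]) auto
qed

text \<open>Beyond a fixed index \<open>N\<close> monotonicity allows replacing \<open>a n * a j\<close> by \<open>(a j)\<^sup>2\<close>, so that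
  this part of the product is bounded by a tail of the convergent series; the
  remaining part is a constant multiple of \<open>a n\<close>.\<close>

lemma decseq_times_partial_sum_tendsto_zero:
  fixes a :: "nat \<Rightarrow> real"
  assumes nonneg: "\<And>n. 0 \<le> a n" and dec: "decseq a" and sq: "summable (\<lambda>n. (a n)\<^sup>2)"
  shows "(\<lambda>n. a n * (\<Sum>j<n. a j)) \<longlonglongrightarrow> 0"
proof (rule LIMSEQ_I)
  fix e :: real assume e: "e > 0"
  obtain N where N: "\<And>n. n \<ge> N \<Longrightarrow> norm (\<Sum>j=N..<n. (a j)\<^sup>2) < e / 2"
    using sq e unfolding summable_Cauchy by (meson half_gt_zero order_refl)
  have "(\<lambda>n. (a n)\<^sup>2) \<longlonglongrightarrow> 0"
    by (rule summable_LIMSEQ_zero[OF sq])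
  then have "a \<longlonglongrightarrow> 0"
    using tendsto_real_sqrt[of "\<lambda>n. (a n)\<^sup>2" 0] nonneg by simp
  then have "(\<lambda>n. a n * (\<Sum>j<N. a j)) \<longlonglongrightarrow> 0 * (\<Sum>j<N. a j)"
    by (intro tendsto_intros)
  then obtain M where M: "\<And>n. n \<ge> M \<Longrightarrow> norm (a n * (\<Sum>j<N. a j)) < e / 2"
    using LIMSEQ_D[of _ "0 * (\<Sum>j<N. a j)" "e/2"] e by auto
  have "norm (a n * (\<Sum>j<n. a j) - 0) < e" if n: "n \<ge> max M N" for n
  proof -
    have "a n * a j \<le> (a j)\<^sup>2" if "j < n" for j
      using that dec nonneg[of j] by (auto simp: power2_eq_square decseq_def intro!: mult_right_mono)
    then have tail: "(\<Sum>j=N..<n. a n * a j) \<le> (\<Sum>j=N..<n. (a j)\<^sup>2)"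
      by (intro sum_mono) auto
    have "a n * (\<Sum>j<n. a j) = a n * (\<Sum>j<N. a j) + (\<Sum>j=N..<n. a n * a j)"
      using n by (simp add: lessThan_atLeast0 sum_distrib_left sum.atLeastLessThan_concat)
    also have "\<dots> < e / 2 + e / 2"
      using M[of n] N[of n] n tail by auto
    finally show ?thesis
      using nonneg by (simp add: sum_nonneg)
  qed
  then show "\<exists>no. \<forall>n\<ge>no. norm (a n * (\<Sum>j<n. a j) - 0) < e" by blast
qed

text \<open>The implicit form of the step is what makes the gradient norm decrease: by monotonicity
  \<open>\<nabla>\<psi>(y\<^sub>n\<^sub>+\<^sub>1) - \<nabla>\<psi>(y\<^sub>n)\<close> makes an obtuse angle with \<open>\<nabla>\<psi>(y\<^sub>n\<^sub>+\<^sub>1)\<close>, whatever the step size.\<close>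

lemma proximal_sequence_gradient_decseq:
  fixes \<psi> :: "'a::real_inner \<Rightarrow> real"
  assumes conv: "convex_on UNIV \<psi>" and grad: "\<And>y. GDERIV \<psi> y :> g y" and l: "\<tau> > 0"
    and step: "\<And>n. y (Suc n) = y n - \<tau> *\<^sub>R g (y (Suc n))"
  shows "decseq (\<lambda>n. norm (g (y n)))"
proof (rule decseq_SucI)
  fix n
  let ?p = "g (y n)" and ?q = "g (y (Suc n))"
  have "y n - y (Suc n) = \<tau> *\<^sub>R ?q"
    using step[of n] by (simp add: algebra_simps)
  then have "0 \<le> \<tau> * ((?p - ?q) \<bullet> ?q)"
    using convex_gradient_monotone[OF conv grad grad, of "y n" "y (Suc n)"] by simp
  then have "?q \<bullet> ?q \<le> ?p \<bullet> ?q"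
    using l by (simp add: zero_le_mult_iff inner_diff_left)
  also have "\<dots> \<le> norm ?p * norm ?q"
    by (rule norm_cauchy_schwarz)
  finally have "norm ?q * norm ?q \<le> norm ?p * norm ?q"
    by (simp add: dot_square_norm power2_eq_square)
  then show "norm ?q \<le> norm ?p"
    by (cases "?q = 0") auto
qed

text \<open>The iteration may be unbounded, but its gradients decay faster than it can escape.\<close>

lemma proximal_sequence_gradient_times_distance:
  fixes \<psi> :: "'a::real_inner \<Rightarrow> real"
  assumes conv: "convex_on UNIV \<psi>" and grad: "\<And>y. GDERIV \<psi> y :> g y"
    and bdd: "bdd_below (range \<psi>)" and l: "\<tau> > 0"
    and step: "\<And>n. y (Suc n) = y n - \<tau> *\<^sub>R g (y (Suc n))"
  shows "(\<lambda>n. norm (g (y n)) * norm (y n - z)) \<longlonglongrightarrow> 0"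
proof -
  define G where "G n = norm (g (y n))" for n
  have G_nonneg: "0 \<le> G n" for n by (simp add: G_def)
  have dec: "decseq G"
    using proximal_sequence_gradient_decseq[where g = g and y = y, OF conv grad l step] by (simp add: G_def[abs_def])
  have diff: "y n - y (Suc n) = \<tau> *\<^sub>R g (y (Suc n))" for n
    using step[of n] by (simp add: algebra_simps)
  obtain m where m: "\<And>y. m \<le> \<psi> y"
    using bdd by (auto simp: bdd_below_def)
  have descent: "\<tau> * (G (Suc n))\<^sup>2 \<le> \<psi> (y n) - \<psi> (y (Suc n))" for n
    using convex_tangent_inequality[OF conv grad, of "y (Suc n)" "y n"] diff[of n]
    by (simp add: G_def dot_square_norm)
  have "(\<Sum>n<k. (G (Suc n))\<^sup>2) \<le> (\<psi> (y 0) - m) / \<tau>" for k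
  proof -
    have "\<tau> * (\<Sum>n<k. (G (Suc n))\<^sup>2) \<le> (\<Sum>n<k. \<psi> (y n) - \<psi> (y (Suc n)))"
      unfolding sum_distrib_left by (intro sum_mono descent)
    also have "\<dots> \<le> \<psi> (y 0) - m"
      using m[of "y k"] sum_lessThan_telescope'[of "\<lambda>n. \<psi> (y n)" k] by simp
    finally show ?thesis
      using l by (simp add: field_simps)
  qed
  then have "summable (\<lambda>n. (G (Suc n))\<^sup>2)"
    by (intro summableI_nonneg_bounded) auto
  then have sq: "summable (\<lambda>n. (G n)\<^sup>2)"
    using summable_Suc_iff[of "\<lambda>n. (G n)\<^sup>2"] by simp
  have "norm (y n - y 0) \<le> \<tau> * (\<Sum>j<n. G j)" for n
  proof (induction n)
    case (Suc n)
    have "norm (y (Suc n) - y 0) \<le> norm (y (Suc n) - y n) + norm (y n - y 0)"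
      using norm_triangle_ineq[of "y (Suc n) - y n" "y n - y 0"] by simp
    also have "norm (y (Suc n) - y n) = \<tau> * G (Suc n)"
      using l diff[of n] by (simp add: norm_minus_commute G_def)
    also have "\<dots> \<le> \<tau> * G n"
      using l dec by (simp add: decseq_Suc_iff)
    finally show ?case
      using Suc by (simp add: algebra_simps)
  qed simp
  moreover have "norm (y n - z) \<le> norm (y n - y 0) + norm (y 0 - z)" for n
    using norm_triangle_ineq[of "y n - y 0" "y 0 - z"] by simp
  ultimately have dist_le: "norm (y n - z) \<le> \<tau> * (\<Sum>j<n. G j) + norm (y 0 - z)" for n
    by (meson add_right_mono order_trans)
  have "(\<lambda>n. \<tau> * (G n * (\<Sum>j<n. G j)) + G n * norm (y 0 - z)) \<longlonglongrightarrow> \<tau> * 0 + 0 * norm (y 0 - z)"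
  proof (intro tendsto_intros)
    show "(\<lambda>n. G n * (\<Sum>j<n. G j)) \<longlonglongrightarrow> 0"
      by (rule decseq_times_partial_sum_tendsto_zero[OF G_nonneg dec sq])
    show "G \<longlonglongrightarrow> 0"
      using tendsto_real_sqrt[OF summable_LIMSEQ_zero[OF sq]] G_nonneg by simp
  qed
  then have upper: "(\<lambda>n. G n * (\<tau> * (\<Sum>j<n. G j) + norm (y 0 - z))) \<longlonglongrightarrow> 0"
    by (simp add: algebra_simps)
  have "(\<lambda>n. G n * norm (y n - z)) \<longlonglongrightarrow> 0"
  proof (rule tendsto_sandwich[OF _ _ tendsto_const upper])
    show "\<forall>\<^sub>F n in sequentially. 0 \<le> G n * norm (y n - z)"
      using G_nonneg by simp
    show "\<forall>\<^sub>F n in sequentially. G n * norm (y n - z) \<le> G n * (\<tau> * (\<Sum>j<n. G j) + norm (y 0 - z))"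
      using G_nonneg dist_le by (simp add: mult_left_mono)
  qed
  then show ?thesis by (simp add: G_def)
qed

section \<open>Comparison of two functions with equal gradient norms\<close>

text \<open>The iteration for \<open>\<psi>\<^sub>1\<close> started at \<open>x\<close> transports a bound on \<open>\<psi>\<^sub>1 - \<psi>\<^sub>2\<close> from its far
  end, where \<open>\<psi>\<^sub>2\<close> is eventually at most \<open>\<psi>\<^sub>2 z\<close> up to a small error, back to \<open>x\<close>. The bound
  holds for every \<open>z\<close>, so that the infimum of \<open>\<psi>\<^sub>2\<close> can be taken afterwards.\<close>

lemma equal_gradient_norm_comparison:
  fixes \<psi>\<^sub>1 \<psi>\<^sub>2 :: "'a::{real_inner,complete_space} \<Rightarrow> real"
  assumes conv1: "convex_on UNIV \<psi>\<^sub>1" and grad1: "\<And>y. GDERIV \<psi>\<^sub>1 y :> g\<^sub>1 y"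
    and conv2: "convex_on UNIV \<psi>\<^sub>2" and grad2: "\<And>y. GDERIV \<psi>\<^sub>2 y :> g\<^sub>2 y"
    and eq: "\<And>y. norm (g\<^sub>1 y) = norm (g\<^sub>2 y)"
    and m: "\<And>y. m \<le> \<psi>\<^sub>1 y"
  shows "m - \<psi>\<^sub>2 z \<le> \<psi>\<^sub>1 x - \<psi>\<^sub>2 x"
proof -
  have bdd: "bdd_below (range \<psi>\<^sub>1)"
    using m by (intro bdd_belowI) auto
  have approx: "m - \<psi>\<^sub>2 z \<le> \<psi>\<^sub>1 x - \<psi>\<^sub>2 x + \<tau> * (norm (g\<^sub>1 x))\<^sup>2" if l: "\<tau> > 0" for \<tau>
  proof -
    obtain y where y0: "y 0 = x" and step: "\<And>n. y (Suc n) = y n - \<tau> *\<^sub>R g\<^sub>1 (y (Suc n))"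
      using proximal_sequence_exists[where x = x and g = g\<^sub>1, OF conv1 grad1 bdd l] by blast
    define G where "G n = norm (g\<^sub>1 (y n))" for n
    have dec: "decseq G"
      using proximal_sequence_gradient_decseq[where g = g\<^sub>1 and y = y, OF conv1 grad1 l step] by (simp add: G_def[abs_def])
    have diff: "y n - y (Suc n) = \<tau> *\<^sub>R g\<^sub>1 (y (Suc n))" for n
      using step[of n] by (simp add: algebra_simps)
    have one_step: "\<psi>\<^sub>1 (y (Suc n)) - \<psi>\<^sub>2 (y (Suc n))
        \<le> \<psi>\<^sub>1 (y n) - \<psi>\<^sub>2 (y n) + \<tau> * (G 0 * (G n - G (Suc n)))" for n
    proof -
      (* The tangent of \<psi>\<^sub>1 is taken at the new point and that of \<psi>\<^sub>2 at the old one, so that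
         both inequalities bound the increment of the difference from above. *)
      have "\<tau> * (G (Suc n))\<^sup>2 \<le> \<psi>\<^sub>1 (y n) - \<psi>\<^sub>1 (y (Suc n))"
        using convex_tangent_inequality[OF conv1 grad1, of "y (Suc n)" "y n"] diff[of n]
        by (simp add: G_def dot_square_norm)
      moreover have "\<psi>\<^sub>2 (y n) - \<psi>\<^sub>2 (y (Suc n)) \<le> \<tau> * (G n * G (Suc n))"
      proof -
        have "\<psi>\<^sub>2 (y n) - \<psi>\<^sub>2 (y (Suc n)) \<le> g\<^sub>2 (y n) \<bullet> (y n - y (Suc n))"
          using convex_tangent_inequality[OF conv2 grad2, of "y n" "y (Suc n)"]
          by (simp add: inner_diff_right)
        also have "\<dots> = \<tau> * (g\<^sub>2 (y n) \<bullet> g\<^sub>1 (y (Suc n)))"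
          by (simp add: diff)
        also have "\<dots> \<le> \<tau> * (G n * G (Suc n))"
          using l norm_cauchy_schwarz[of "g\<^sub>2 (y n)" "g\<^sub>1 (y (Suc n))"] by (simp add: G_def eq)
        finally show ?thesis .
      qed
      moreover have "\<tau> * (G (Suc n) * (G n - G (Suc n))) \<le> \<tau> * (G 0 * (G n - G (Suc n)))"
        using l dec by (intro mult_left_mono mult_right_mono) (auto simp: decseq_def)
      ultimately show ?thesis
        by (simp add: algebra_simps power2_eq_square)
    qed
    have "\<psi>\<^sub>1 (y n) - \<psi>\<^sub>2 (y n) \<le> \<psi>\<^sub>1 x - \<psi>\<^sub>2 x + \<tau> * (G 0 * (G 0 - G n))" for n
    proof (induction n)
      case (Suc n)
      then show ?case using one_step[of n] by (simp add: algebra_simps)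
    qed (simp add: y0)
    moreover have "\<tau> * (G 0 * (G 0 - G n)) \<le> \<tau> * (norm (g\<^sub>1 x))\<^sup>2" for n
      using l by (simp add: G_def y0 power2_eq_square mult_left_mono)
    moreover have "\<psi>\<^sub>2 (y n) \<le> \<psi>\<^sub>2 z + G n * norm (y n - z)" for n
    proof -
      have "\<psi>\<^sub>2 (y n) - \<psi>\<^sub>2 z \<le> g\<^sub>2 (y n) \<bullet> (y n - z)"
        using convex_tangent_inequality[OF conv2 grad2, of "y n" z] by (simp add: inner_diff_right)
      also have "\<dots> \<le> G n * norm (y n - z)"
        unfolding G_def eq by (rule norm_cauchy_schwarz)
      finally show ?thesis by simp
    qed
    ultimately have "m - \<psi>\<^sub>2 z - (\<psi>\<^sub>1 x - \<psi>\<^sub>2 x + \<tau> * (norm (g\<^sub>1 x))\<^sup>2) \<le> G n * norm (y n - z)" for n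
      using m[of "y n"] by (smt (verit))
    moreover have "(\<lambda>n. G n * norm (y n - z)) \<longlonglongrightarrow> 0"
      unfolding G_def by (rule proximal_sequence_gradient_times_distance[where g = g\<^sub>1 and y = y, OF conv1 grad1 bdd l step])
    ultimately have "m - \<psi>\<^sub>2 z - (\<psi>\<^sub>1 x - \<psi>\<^sub>2 x + \<tau> * (norm (g\<^sub>1 x))\<^sup>2) \<le> 0"
      by (meson LIMSEQ_le_const)
    then show ?thesis by simp
  qed
  have "((\<lambda>\<tau>. \<psi>\<^sub>1 x - \<psi>\<^sub>2 x + \<tau> * (norm (g\<^sub>1 x))\<^sup>2) \<longlongrightarrow> \<psi>\<^sub>1 x - \<psi>\<^sub>2 x + 0 * (norm (g\<^sub>1 x))\<^sup>2) (at_right 0)"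
    by (intro tendsto_intros)
  moreover have "\<forall>\<^sub>F \<tau> in at_right 0. m - \<psi>\<^sub>2 z \<le> \<psi>\<^sub>1 x - \<psi>\<^sub>2 x + \<tau> * (norm (g\<^sub>1 x))\<^sup>2"
    using approx by (auto simp: eventually_at_filter)
  ultimately have "m - \<psi>\<^sub>2 z \<le> \<psi>\<^sub>1 x - \<psi>\<^sub>2 x + 0 * (norm (g\<^sub>1 x))\<^sup>2"
    by (rule tendsto_lowerbound) simp
  then show ?thesis by simp
qed

theorem corollary3p11:
  fixes f \<psi>\<^sub>1 \<psi>\<^sub>2 :: "'a::{real_inner,complete_space} \<Rightarrow> real"
  assumes "\<forall>x. 0 \<le> f x" and "C1 f"
    and "C2 \<psi>\<^sub>1" and "convex_on UNIV \<psi>\<^sub>1" and "bdd_below (range \<psi>\<^sub>1)"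
    and "\<forall>x. (norm (gradient \<psi>\<^sub>1 x))\<^sup>2 = f x"
    and "C2 \<psi>\<^sub>2" and "convex_on UNIV \<psi>\<^sub>2" and "bdd_below (range \<psi>\<^sub>2)"
    and "\<forall>x. (norm (gradient \<psi>\<^sub>2 x))\<^sup>2 = f x"
  shows "\<exists>c. \<forall>x. \<psi>\<^sub>1 x = \<psi>\<^sub>2 x + c"
proof -
  have grad1: "GDERIV \<psi>\<^sub>1 y :> gradient \<psi>\<^sub>1 y" and grad2: "GDERIV \<psi>\<^sub>2 y :> gradient \<psi>\<^sub>2 y" for y
    using assms(3,7) GDERIV_gradient unfolding C2_def by blast+
  have eq: "norm (gradient \<psi>\<^sub>1 y) = norm (gradient \<psi>\<^sub>2 y)" for y
    using assms(6,10) by (metis norm_ge_zero power2_eq_imp_eq)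
  define m\<^sub>1 where "m\<^sub>1 = Inf (range \<psi>\<^sub>1)"
  define m\<^sub>2 where "m\<^sub>2 = Inf (range \<psi>\<^sub>2)"
  have m1: "m\<^sub>1 \<le> \<psi>\<^sub>1 y" for y
    unfolding m\<^sub>1_def using assms(5) by (intro cInf_lower) auto
  have m2: "m\<^sub>2 \<le> \<psi>\<^sub>2 y" for y
    unfolding m\<^sub>2_def using assms(9) by (intro cInf_lower) auto
  have "\<psi>\<^sub>1 x = \<psi>\<^sub>2 x + (m\<^sub>1 - m\<^sub>2)" for x
  proof -
    have "m\<^sub>1 - (\<psi>\<^sub>1 x - \<psi>\<^sub>2 x) \<le> \<psi>\<^sub>2 z" for z
      using equal_gradient_norm_comparison[OF assms(4) grad1 assms(8) grad2 eq m1, of z x] by simp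
    then have "m\<^sub>1 - (\<psi>\<^sub>1 x - \<psi>\<^sub>2 x) \<le> m\<^sub>2"
      unfolding m\<^sub>2_def by (intro cInf_greatest) auto
    moreover have "m\<^sub>2 - (\<psi>\<^sub>2 x - \<psi>\<^sub>1 x) \<le> \<psi>\<^sub>1 z" for z
      using equal_gradient_norm_comparison[OF assms(8) grad2 assms(4) grad1 eq[symmetric] m2, of z x]
      by simp
    then have "m\<^sub>2 - (\<psi>\<^sub>2 x - \<psi>\<^sub>1 x) \<le> m\<^sub>1"
      unfolding m\<^sub>1_def by (intro cInf_greatest) auto
    ultimately show ?thesis by simp
  qed
  then show ?thesis by blast
qed

end
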